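(* $c_{\mathcal C}(n)\in\Omega(\sqrt n)$, i.e. there exist a constant $c>0$ and an integer $n_0$ such that $c_{\mathcal C}(n)\ge c\sqrt n$ for all integers $n\ge n_0$.
   Context: Let $N=\{1,\dots,n\}$. A simple game on $n$ voters is a function $\chi:2^N\to\{0,1\}$ with $\chi(\emptyset)=0$, $\chi(N)=1$ and $\chi(S)\le\chi(T)$ whenever $S\subseteq T\subseteq N$. A coalition $S$ is winning if $\chi(S)=1$ and losing if $\chi(S)=0$. For voters $i,j\in N$ write $i\sqsupset j$ if $\chi(\{i\}\cup S\setminus\{j\})\ge\chi(S)$ for all $S$ with $j\in S\subseteq N\setminus\{i\}$. The simple game is complete if $\sqsupset$ is a total preorder on $N$; $\mathcal C_n$ is the set of complete simple games on $n$ voters. For real weights write $w(S)=\sum_{i\in S}w_i$. For real $\alpha\ge 1$, $\chi$ is $\alpha$-roughly weighted if there are $w_1,\dots,w_n\in\mathbb R$ with $w(S)\ge 1$ for all winning $S$ and $w(S)\le\alpha$ for all losing $S$. The critical threshold value $\mu(\chi)$ is the smallest $\alpha\ge 1$ such that $\chi$ is $\alpha$-roughly weighted, and $c_{\mathcal C}(n)=\max\{\mu(\chi)\mid\chi\in\mathcal C_n\}$. *)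

theory Defs
  imports Complex_Main "HOL-Library.FuncSet"
begin

definition voters :: "nat \<Rightarrow> nat set" where
  "voters n = {1..n}"

(* Extensional function space: a game is determined by its values on coalitions,
   so that there are only finitely many games for each n. *)
definition simple_game :: "nat \<Rightarrow> (nat set \<Rightarrow> nat) \<Rightarrow> bool" where
  "simple_game n \<chi> \<longleftrightarrow>
     \<chi> \<in> Pow (voters n) \<rightarrow>\<^sub>E {0, 1} \<and>
     \<chi> {} = 0 \<and> \<chi> (voters n) = 1 \<and>
     (\<forall>S T. S \<subseteq> T \<and> T \<subseteq> voters n \<longrightarrow> \<chi> S \<le> \<chi> T)"

definition winning :: "nat \<Rightarrow> (nat set \<Rightarrow> nat) \<Rightarrow> nat set \<Rightarrow> bool" where
  "winning n \<chi> S \<longleftrightarrow> S \<subseteq> voters n \<and> \<chi> S = 1"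

definition losing :: "nat \<Rightarrow> (nat set \<Rightarrow> nat) \<Rightarrow> nat set \<Rightarrow> bool" where
  "losing n \<chi> S \<longleftrightarrow> S \<subseteq> voters n \<and> \<chi> S = 0"

definition desirability :: "nat \<Rightarrow> (nat set \<Rightarrow> nat) \<Rightarrow> nat rel" where
  "desirability n \<chi> =
     {(i, j). i \<in> voters n \<and> j \<in> voters n \<and>
        (\<forall>S. j \<in> S \<and> S \<subseteq> voters n - {i} \<longrightarrow> \<chi> (({i} \<union> S) - {j}) \<ge> \<chi> S)}"

(* total_on only compares distinct elements; reflexivity is part of preorder_on. *)
definition complete_simple_games :: "nat \<Rightarrow> (nat set \<Rightarrow> nat) set" where
  "complete_simple_games n =
     {\<chi>. simple_game n \<chi> \<and>
         preorder_on (voters n) (desirability n \<chi>) \<and>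
         total_on (voters n) (desirability n \<chi>)}"

definition roughly_weighted :: "nat \<Rightarrow> real \<Rightarrow> (nat set \<Rightarrow> nat) \<Rightarrow> bool" where
  "roughly_weighted n \<alpha> \<chi> \<longleftrightarrow>
     (\<exists>w :: nat \<Rightarrow> real.
        (\<forall>S. winning n \<chi> S \<longrightarrow> sum w S \<ge> 1) \<and>
        (\<forall>S. losing n \<chi> S \<longrightarrow> sum w S \<le> \<alpha>))"

(* For a simple game the minimum exists: negative weights may be raised to 0 and weights
   above 1 lowered to 1, so the search for weights is over a compact cube. *)
definition critical_threshold :: "nat \<Rightarrow> (nat set \<Rightarrow> nat) \<Rightarrow> real" where
  "critical_threshold n \<chi> = (LEAST \<alpha>. \<alpha> \<ge> 1 \<and> roughly_weighted n \<alpha> \<chi>)"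

(* There is no simple game on 0 voters, so the value at n = 0 is meaningless. *)
definition c_complete :: "nat \<Rightarrow> real" where
  "c_complete n = Max (critical_threshold n ` complete_simple_games n)"

end

(* Let the first m voters be strong, m being about sqrt n, and let a coalition win iff it has
   more than m members and at least one of them is strong. The weak voters alone lose, and so do
   the m strong voters alone, so both groups have weight at most alpha. By averaging, some strong
   voter has weight at most alpha / m and some m weak voters have total weight at most
   m * alpha / (n - m); together they win, which forces alpha (1/m + m/(n - m)) >= 1. Equality is
   attained by weights that are constant on each group. *)

theory Submission
  imports Defs
begin

text \<open>Discarding a heaviest element never raises the average, so heaviest elements are
  discarded until \<open>k\<close> remain. The comparison of averages is multiplied out and thus
  also makes sense for \<open>k = 0\<close> or empty \<open>B\<close>.\<close>

lemma exists_subset_sum_le_average: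
  fixes w :: "'a \<Rightarrow> real"
  assumes "finite B" and "k \<le> card B"
  shows "\<exists>C\<subseteq>B. card C = k \<and> card B * sum w C \<le> k * sum w B"
  using assms
proof (induction "card B - k" arbitrary: B)
  case 0
  then show ?case by (intro exI[of _ B]) auto
next
  case (Suc d)
  then have "B \<noteq> {}" by auto
  then have "Max (w ` B) \<in> w ` B" using Suc.prems by (intro Max_in) auto
  then obtain b where b: "b \<in> B" "w b = Max (w ` B)" by (metis imageE)
  have max: "w i \<le> w b" if "i \<in> B" for i
    using that Suc.prems b by simp
  obtain c where c: "card B = Suc c" "card (B - {b}) = c"
    using b Suc.prems by (metis card.remove)
  have "d = card (B - {b}) - k" "k \<le> card (B - {b})" "finite (B - {b})"
    unfolding c(2) using Suc.hyps(2) Suc.prems c(1) by simp_all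
  then obtain C where C: "C \<subseteq> B - {b}" "card C = k"
    and le: "c * sum w C \<le> k * sum w (B - {b})"
    using Suc.hyps(1)[of "B - {b}"] unfolding c(2) by blast
  \<comment> \<open>The \<open>k\<close> survivors weigh at most \<open>w b\<close> each. This pays
    for the additional \<open>sum w C\<close> that appears when the factor grows from
    \<open>c\<close> to \<open>Suc c\<close>.\<close>
  have "sum w C \<le> k * w b"
    using sum_bounded_above[of C w "w b"] max C by auto
  moreover have "sum w B = w b + sum w (B - {b})"
    using b Suc.prems by (simp add: sum.remove)
  moreover have "card B * sum w C = c * sum w C + sum w C"
    unfolding c(1) by (simp add: algebra_simps)
  ultimately have "card B * sum w C \<le> k * sum w B"
    using le by (simp add: distrib_left)
  with C show ?case by blast
qed

text \<open>The strong voters are \<open>{1..m}\<close>. The restriction to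
  \<open>Pow (voters n)\<close> places the game in the extensional function space that
  \<open>simple_game\<close> demands.\<close>

definition two_class_game :: "nat \<Rightarrow> nat \<Rightarrow> nat set \<Rightarrow> nat" where
  "two_class_game n m =
     (\<lambda>S\<in>Pow (voters n). if S \<inter> {1..m} \<noteq> {} \<and> m < card S then 1 else 0)"

lemma finite_voters [simp]: "finite (voters n)"
  by (simp add: voters_def)

lemma two_class_game_eq:
  "S \<subseteq> voters n \<Longrightarrow>
     two_class_game n m S = (if S \<inter> {1..m} \<noteq> {} \<and> m < card S then 1 else 0)"
  by (simp add: two_class_game_def)

text \<open>Comparing sizes instead of assuming inclusion lets this serve both for monotonicity and
  for swapping one voter for another.\<close>

lemma two_class_game_mono:
  assumes "S \<subseteq> voters n" "T \<subseteq> voters n" "card S \<le> card T"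
    and "S \<inter> {1..m} \<noteq> {} \<Longrightarrow> T \<inter> {1..m} \<noteq> {}"
  shows "two_class_game n m S \<le> two_class_game n m T"
  using assms by (subst (1 2) two_class_game_eq) auto

lemma simple_two_class_game:
  assumes "1 \<le> m" "m < n"
  shows "simple_game n (two_class_game n m)"
  unfolding simple_game_def
proof (intro conjI allI impI)
  show "two_class_game n m \<in> Pow (voters n) \<rightarrow>\<^sub>E {0, 1}"
    by (auto simp: two_class_game_def)
  show "two_class_game n m {} = 0" by (simp add: two_class_game_eq)
  have "1 \<in> voters n \<inter> {1..m}" using assms by (auto simp: voters_def)
  then show "two_class_game n m (voters n) = 1"
    using assms by (auto simp: two_class_game_eq voters_def)
  fix S T assume ST: "S \<subseteq> T \<and> T \<subseteq> voters n"
  then have "card S \<le> card T" by (metis card_mono finite_subset finite_voters)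
  with ST show "two_class_game n m S \<le> two_class_game n m T"
    by (intro two_class_game_mono) auto
qed

text \<open>A swap keeps the size, so it can only hurt by removing the last strong member, which
  requires \<open>j\<close> strong and \<open>i\<close> weak. In this form the relation is visibly a
  total preorder with two classes.\<close>

lemma desirability_two_class_game:
  assumes "1 \<le> m" "2 * m < n"
  shows "desirability n (two_class_game n m) =
    {(i, j). i \<in> voters n \<and> j \<in> voters n \<and> (j \<le> m \<longrightarrow> i \<le> m)}"
proof -
  let ?\<chi> = "two_class_game n m"
  have exchange: "?\<chi> S \<le> ?\<chi> (({i} \<union> S) - {j})"
    if "i \<in> voters n" "j \<in> S" "S \<subseteq> voters n - {i}" "j \<le> m \<longrightarrow> i \<le> m" for i j S
  proof -
    have S: "S \<subseteq> voters n" "finite S" "i \<notin> S"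
      using that(3) finite_subset[OF _ finite_voters[of n]] by auto
    have T: "({i} \<union> S) - {j} = insert i (S - {j})" using that(2) S(3) by auto
    have sub: "insert i (S - {j}) \<subseteq> voters n" using that(1) S(1) by auto
    \<comment> \<open>Needed because \<open>card S - 1\<close> is a truncated subtraction.\<close>
    have "card S > 0" using S(2) that(2) by (auto simp: card_gt_0_iff)
    then have card: "card (insert i (S - {j})) = card S" using S that(2) by simp
    have "insert i (S - {j}) \<inter> {1..m} \<noteq> {}" if ne: "S \<inter> {1..m} \<noteq> {}"
    proof (cases "i \<le> m")
      case True
      with \<open>i \<in> voters n\<close> show ?thesis by (auto simp: voters_def)
    next
      case False
      obtain k where "k \<in> S" "k \<in> {1..m}" using ne by blast
      \<comment> \<open>Since \<open>i\<close> is weak, \<open>j\<close> is weak too, so the strong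
        member \<open>k\<close> survives the swap.\<close>
      moreover from this False \<open>j \<le> m \<longrightarrow> i \<le> m\<close> have "k \<noteq> j" by auto
      ultimately show ?thesis by blast
    qed
    then show ?thesis
      unfolding T using S(1) sub card by (intro two_class_game_mono) simp_all
  qed
  have no_exchange: "i \<le> m"
    if ij: "i \<in> voters n" "j \<in> voters n" and "j \<le> m"
      and des: "\<forall>S. j \<in> S \<and> S \<subseteq> voters n - {i} \<longrightarrow> ?\<chi> S \<le> ?\<chi> (({i} \<union> S) - {j})" for i j
  proof (rule ccontr)
    assume i: "\<not> i \<le> m"
    \<comment> \<open>By \<open>2 * m < n\<close> there are at least \<open>m + 1\<close> weak
      voters, so \<open>m\<close> are left besides \<open>i\<close>. With \<open>j\<close> they win;
      with \<open>i\<close> in place of \<open>j\<close> they have no strong member.\<close>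
    have "m \<le> card ({m+1..n} - {i})"
      using assms by (auto simp: card_Diff_singleton_if)
    then obtain C where C: "C \<subseteq> {m+1..n} - {i}" "card C = m"
      by (metis obtain_subset_with_card_n)
    have fin: "finite C" using C(1) by (rule finite_subset) simp
    have "j \<notin> C" using C(1) \<open>j \<le> m\<close> by fastforce
    then have card: "card (insert j C) = Suc m" using C(2) fin by simp
    have "C \<subseteq> voters n - {i}" using C(1) by (fastforce simp: voters_def)
    moreover have "i \<noteq> j" using i \<open>j \<le> m\<close> by blast
    ultimately have sub: "insert j C \<subseteq> voters n - {i}" using ij(2) by blast
    then have S: "insert j C \<subseteq> voters n" and T: "({i} \<union> insert j C) - {j} \<subseteq> voters n"
      using ij(1) by blast+
    have "j \<in> {1..m}" using ij(2) \<open>j \<le> m\<close> by (simp add: voters_def)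
    then have "insert j C \<inter> {1..m} \<noteq> {}" by blast
    then have "?\<chi> (insert j C) = 1"
      unfolding two_class_game_eq[OF S] card by simp
    moreover have "(({i} \<union> insert j C) - {j}) \<inter> {1..m} = {}" using C(1) i by fastforce
    then have "?\<chi> (({i} \<union> insert j C) - {j}) = 0"
      unfolding two_class_game_eq[OF T] by (simp only: simp_thms if_False)
    ultimately show False using des sub by (metis insertI1 not_one_le_zero)
  qed
  have "(\<forall>S. j \<in> S \<and> S \<subseteq> voters n - {i} \<longrightarrow> ?\<chi> S \<le> ?\<chi> (({i} \<union> S) - {j}))
      \<longleftrightarrow> (j \<le> m \<longrightarrow> i \<le> m)" if "i \<in> voters n" "j \<in> voters n" for i j
  proof (intro iffI impI allI)
    assume des: "\<forall>S. j \<in> S \<and> S \<subseteq> voters n - {i} \<longrightarrow> ?\<chi> S \<le> ?\<chi> (({i} \<union> S) - {j})"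
      and "j \<le> m"
    show "i \<le> m" using no_exchange[OF that \<open>j \<le> m\<close> des] .
  next
    fix S assume le: "j \<le> m \<longrightarrow> i \<le> m" and S: "j \<in> S \<and> S \<subseteq> voters n - {i}"
    show "?\<chi> S \<le> ?\<chi> (({i} \<union> S) - {j})"
      using exchange[OF that(1) conjunct1[OF S] conjunct2[OF S] le] .
  qed
  then show ?thesis unfolding desirability_def by (intro Collect_cong) auto
qed

lemma complete_two_class_game:
  assumes "1 \<le> m" "2 * m < n"
  shows "two_class_game n m \<in> complete_simple_games n"
  unfolding complete_simple_games_def mem_Collect_eq desirability_two_class_game[OF assms]
proof (intro conjI)
  show "simple_game n (two_class_game n m)" using assms by (simp add: simple_two_class_game)
qed (auto simp: preorder_on_def refl_on_def trans_def total_on_def)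

lemma winning_two_class_game:
  "winning n (two_class_game n m) S \<longleftrightarrow> S \<subseteq> voters n \<and> S \<inter> {1..m} \<noteq> {} \<and> m < card S"
  by (cases "S \<subseteq> voters n") (simp_all add: winning_def two_class_game_eq)

lemma losing_two_class_game:
  "losing n (two_class_game n m) S \<longleftrightarrow> S \<subseteq> voters n \<and> (S \<inter> {1..m} = {} \<or> card S \<le> m)"
  by (cases "S \<subseteq> voters n") (simp_all add: losing_def two_class_game_eq not_less)

text \<open>Here \<open>b\<close> counts the weak voters, and the value solves \<alpha> (1/m + m/b)
  = 1. The bounds on \<open>m\<close> and \<open>n\<close> keep it at least 1, as
  \<open>critical_threshold\<close> demands.\<close>

lemma critical_threshold_two_class_game:
  assumes m: "2 \<le> m" and n: "3 * m \<le> n"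
  defines "b \<equiv> real (n - m)"
  shows "critical_threshold n (two_class_game n m) = m * b / (b + m ^ 2)"
  unfolding critical_threshold_def
proof (rule Least_equality, intro conjI)
  let ?\<alpha> = "m * b / (b + real m ^ 2)"
  have b: "2 * m \<le> b" using m n by (auto simp: b_def)
  \<comment> \<open>The target amounts to m^2 \<le> (m - 1) b; with b \<ge> 2m and m \<ge> 2 the
    right side is at least 2m^2 - 2m \<ge> m^2.\<close>
  have "(real m - 1) * (2 * real m) \<le> (real m - 1) * b" using b m by (intro mult_left_mono) auto
  moreover have "2 * real m \<le> real m * real m" using m by (intro mult_right_mono) auto
  ultimately have "b + real m ^ 2 \<le> m * b"
    by (simp add: power2_eq_square algebra_simps)
  moreover have pos: "b + real m ^ 2 > 0" using b m by (simp add: add_pos_pos)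
  ultimately show ge1: "1 \<le> ?\<alpha>" by (simp add: field_simps)
  \<comment> \<open>Each class gets total weight exactly \<open>?\<alpha>\<close>; then one strong
    and \<open>m\<close> weak voters together weigh exactly 1.\<close>
  define x y where "x = ?\<alpha> / m" and "y = ?\<alpha> / b"
  have mx: "m * x = ?\<alpha>" and "b * y = ?\<alpha>" using m b by (auto simp: x_def y_def)
  have "x = b / (b + real m ^ 2)" "y = m / (b + real m ^ 2)" using m b by (auto simp: x_def y_def)
  then have xmy: "x + m * y = 1"
    using pos by (simp add: add_divide_distrib[symmetric] power2_eq_square)
  have "0 \<le> y" using ge1 b by (auto simp: y_def)
  have "y \<le> x" unfolding x_def y_def using ge1 b m by (intro divide_left_mono) auto
  define w where "w i = (if i \<le> m then x else y)" for i
  have sum_w: "sum w S = card (S \<inter> {1..m}) * x + card (S - {1..m}) * y"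
    and card_S: "card S = card (S \<inter> {1..m}) + card (S - {1..m})"
    if "S \<subseteq> voters n" for S
  proof -
    have fin: "finite S" using that by (rule finite_subset) simp
    have "sum w S = sum w (S \<inter> {1..m}) + sum w (S - {1..m})"
      using fin by (rule sum.Int_Diff)
    also have "sum w (S \<inter> {1..m}) = card (S \<inter> {1..m}) * x"
      by (simp add: w_def)
    also have "sum w (S - {1..m}) = (\<Sum>i\<in>S - {1..m}. y)"
      using that by (intro sum.cong) (auto simp: w_def voters_def)
    finally show "sum w S = card (S \<inter> {1..m}) * x + card (S - {1..m}) * y" by simp
    show "card S = card (S \<inter> {1..m}) + card (S - {1..m})"
      using fin by (rule card_Int_Diff)
  qed
  show "roughly_weighted n ?\<alpha> (two_class_game n m)"
    unfolding roughly_weighted_def winning_two_class_game losing_two_class_game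
  proof (intro exI[of _ w] conjI allI impI)
    fix S assume S: "S \<subseteq> voters n \<and> S \<inter> {1..m} \<noteq> {} \<and> m < card S"
    define s t where "s = card (S \<inter> {1..m})" and "t = card (S - {1..m})"
    have s: "1 \<le> s" using S by (simp add: s_def Suc_le_eq card_gt_0_iff)
    have "m + 1 \<le> s + t" using S card_S[of S] by (auto simp: s_def t_def)
    then have st: "real m + 1 \<le> real s + real t" by linarith
    \<comment> \<open>Start from one strong and \<open>m\<close> weak voters and trade
      \<open>s - 1\<close> of the weak ones for strong ones; each trade adds \<open>x - y\<close>,
      which is nonnegative.\<close>
    have "1 \<le> x + m * y + (real s - 1) * (x - y)"
      using s xmy \<open>y \<le> x\<close> by simp
    also have "\<dots> = s * x + (m + 1 - real s) * y" by (simp add: algebra_simps)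
    also have "\<dots> \<le> s * x + t * y"
      using st \<open>0 \<le> y\<close> by (intro add_left_mono mult_right_mono) auto
    finally show "1 \<le> sum w S" using S sum_w by (simp add: s_def t_def)
  next
    fix S assume S: "S \<subseteq> voters n \<and> (S \<inter> {1..m} = {} \<or> card S \<le> m)"
    define s t where "s = card (S \<inter> {1..m})" and "t = card (S - {1..m})"
    have sum: "sum w S = s * x + t * y" using S sum_w by (simp add: s_def t_def)
    show "sum w S \<le> ?\<alpha>"
    proof (cases "S \<inter> {1..m} = {}")
      case True
      have "S - {1..m} \<subseteq> {m+1..n}" using S by (auto simp: voters_def)
      then have "t \<le> n - m" using card_mono[of "{m+1..n}"] by (fastforce simp: t_def)
      then have "t * y \<le> b * y" using \<open>0 \<le> y\<close> by (intro mult_right_mono) (auto simp: b_def)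
      then show ?thesis using True sum \<open>b * y = ?\<alpha>\<close> by (simp add: s_def)
    next
      case False
      \<comment> \<open>At most \<open>m\<close> members, none heavier than \<open>x\<close>, weigh
        at most \<open>m * x = ?\<alpha>\<close>.\<close>
      then have "s + t \<le> m" using S card_S by (auto simp: s_def t_def)
      then have "real s + real t \<le> real m" by linarith
      then have "(real s + real t) * x \<le> m * x"
        using \<open>0 \<le> y\<close> \<open>y \<le> x\<close> by (intro mult_right_mono) auto
      moreover have "t * y \<le> t * x" using \<open>y \<le> x\<close> by (intro mult_left_mono) auto
      ultimately show ?thesis using sum mx by (simp add: algebra_simps)
    qed
  qed
  fix \<alpha> assume "1 \<le> \<alpha> \<and> roughly_weighted n \<alpha> (two_class_game n m)"
  then obtain v where v: "\<forall>S. winning n (two_class_game n m) S \<longrightarrow> 1 \<le> sum v S"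
      "\<forall>S. losing n (two_class_game n m) S \<longrightarrow> sum v S \<le> \<alpha>"
    unfolding roughly_weighted_def by (elim conjE exE)
  have win: "1 \<le> sum v S" if "S \<subseteq> voters n" "S \<inter> {1..m} \<noteq> {}" "m < card S" for S
    using v(1) that by (simp add: winning_two_class_game)
  have lose: "sum v S \<le> \<alpha>" if "S \<subseteq> voters n" "S \<inter> {1..m} = {} \<or> card S \<le> m" for S
    using v(2) that by (simp add: losing_two_class_game)
  \<comment> \<open>The weights \<open>v\<close> are arbitrary, possibly negative and not constant
    on the classes, so only the class averages are available.\<close>
  obtain A where A: "A \<subseteq> {1..m}" "card A = 1" "m * sum v A \<le> sum v {1..m}"
    using exists_subset_sum_le_average[of "{1..m}" 1 v] m by auto
  have "m \<le> card {m+1..n}" using n by simp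
  then obtain C where C: "C \<subseteq> {m+1..n}" "card C = m" "b * sum v C \<le> m * sum v {m+1..n}"
    using exists_subset_sum_le_average[of "{m+1..n}" m v] unfolding b_def by auto
  have fin: "finite A" "finite C"
    using finite_subset[OF A(1)] finite_subset[OF C(1)] by simp_all
  have disj: "A \<inter> C = {}" using A(1) C(1) by fastforce
  have "1 \<le> sum v (A \<union> C)"
  proof (rule win)
    show "A \<union> C \<subseteq> voters n" using A C m n by (force simp: voters_def)
    show "(A \<union> C) \<inter> {1..m} \<noteq> {}" using A by (auto simp: card_1_singleton_iff)
    show "m < card (A \<union> C)" using A(2) C(2) m fin disj by (simp add: card_Un_disjoint)
  qed
  \<comment> \<open>The factor \<open>m * b\<close> clears the denominators of both
    averages.\<close>
  then have "m * b * 1 \<le> m * b * (sum v A + sum v C)"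
    using fin disj b by (intro mult_left_mono) (auto simp: sum.union_disjoint)
  also have "\<dots> = b * (m * sum v A) + m * (b * sum v C)" by (simp add: algebra_simps)
  also have "\<dots> \<le> b * \<alpha> + m * (m * \<alpha>)"
  proof (intro add_mono mult_left_mono)
    have "sum v {1..m} \<le> \<alpha>" using n by (intro lose) (auto simp: voters_def)
    with A show "m * sum v A \<le> \<alpha>" by linarith
    have "sum v {m+1..n} \<le> \<alpha>" by (intro lose) (auto simp: voters_def)
    then have "m * sum v {m+1..n} \<le> m * \<alpha>" by (intro mult_left_mono) auto
    with C show "b * sum v C \<le> m * \<alpha>" by linarith
  qed (auto simp: b_def)
  finally show "?\<alpha> \<le> \<alpha>"
    using pos by (simp add: divide_le_eq power2_eq_square algebra_simps)
qed

text \<open>\<open>Max\<close> is meaningful only on a finite set; finiteness holds because games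
  are extensional functions on the finitely many coalitions.\<close>

lemma critical_threshold_le_c_complete:
  assumes "\<chi> \<in> complete_simple_games n"
  shows "critical_threshold n \<chi> \<le> c_complete n"
proof -
  have "complete_simple_games n \<subseteq> Pow (voters n) \<rightarrow>\<^sub>E {0, 1}"
    by (auto simp: complete_simple_games_def simple_game_def)
  then have "finite (complete_simple_games n)"
    by (rule finite_subset) (auto intro!: finite_PiE)
  with assms show ?thesis unfolding c_complete_def by (intro Max_ge) auto
qed

theorem mainTheorem3:
  "\<exists>c::real. c > 0 \<and> (\<exists>n0::nat. \<forall>n\<ge>n0. c_complete n \<ge> c * sqrt (real n))"
\<comment> \<open>The constant is 1/3 times 1/2: the threshold is at least m/3, and sqrt n \<le> m +
  1 \<le> 2m. Taking n \<ge> 9 gives m \<ge> 3, hence 3m \<le> m^2 \<le> n.\<close>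
proof (intro exI[of _ "1 / 6"] conjI exI[of _ 9] allI impI)
  fix n :: nat assume "9 \<le> n"
  define m where "m = nat \<lfloor>sqrt n\<rfloor>"
  have m_le: "m \<le> sqrt n" and m_ge: "sqrt n \<le> m + 1"
    unfolding m_def by (simp, linarith)
  have "3 \<le> sqrt n" using \<open>9 \<le> n\<close> by (intro real_le_rsqrt) simp
  then have "3 \<le> m" unfolding m_def by (simp add: le_nat_iff le_floor_iff)
  have "real m * real m \<le> sqrt n * sqrt n" using m_le by (intro mult_mono) auto
  then have "real (m * m) \<le> real n" by simp
  then have "m * m \<le> n" by (simp only: of_nat_le_iff)
  have "3 * m \<le> m * m" using \<open>3 \<le> m\<close> by simp
  with \<open>m * m \<le> n\<close> have "m \<le> n" by linarith
  define b where "b = real (n - m)"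
  have "real m * real m \<le> m + b" using \<open>real (m * m) \<le> real n\<close> \<open>m \<le> n\<close> by (simp add: b_def of_nat_diff)
  moreover have "3 * real m \<le> real m * real m" using \<open>3 \<le> m\<close> by simp
  \<comment> \<open>From m \<le> m^2/3 and m^2 \<le> m + b follows m^2 \<le> 3b/2. The denominator b
    + m^2 is then at most 3b, which yields the bound m/3.\<close>
  ultimately have "real m ^ 2 \<le> 2 * b" "0 < b"
    unfolding power2_eq_square using \<open>3 \<le> m\<close> by linarith+
  have "m * (b + real m ^ 2) \<le> m * (3 * b)"
    using \<open>real m ^ 2 \<le> 2 * b\<close> by (intro mult_left_mono) auto
  then have "m / 3 \<le> m * b / (b + real m ^ 2)"
    using \<open>0 < b\<close> by (subst pos_le_divide_eq) (auto simp: add_pos_nonneg)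
  also have "\<dots> = critical_threshold n (two_class_game n m)"
    unfolding b_def
  proof (rule critical_threshold_two_class_game[symmetric])
    show "2 \<le> m" "3 * m \<le> n" using \<open>3 \<le> m\<close> \<open>3 * m \<le> m * m\<close> \<open>m * m \<le> n\<close> by linarith+
  qed
  also have "\<dots> \<le> c_complete n"
    using \<open>3 \<le> m\<close> \<open>3 * m \<le> m * m\<close> \<open>m * m \<le> n\<close>
    by (intro critical_threshold_le_c_complete complete_two_class_game) linarith+
  finally show "1 / 6 * sqrt n \<le> c_complete n" using m_ge \<open>3 \<le> m\<close> by simp
qed simp

end
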